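(* Ophelia (the second player) can force a draw when playing Tic-Tac-Toe on each of the following designs: (i) any $\mathrm{BIBD}(v,k,1)$ with $k\ge 2$ and $v<\dfrac{-k+1+\sqrt{(k+1)^2+k(k-1)2^{k+2}}}{2}$; (ii) any $\mathrm{TD}(k,n)$ with $k\ge 2$ and $n\le 2^{k/2}-\tfrac12$; (iii) any $\mathrm{TD}(4,4)$.
   Context: A $\mathrm{BIBD}(v,k,\lambda)$ is a pair $(X,\mathcal{B})$ where $X$ is a set of $v$ points and $\mathcal{B}$ is a collection of $k$-element subsets of $X$ (blocks) such that every pair of distinct points of $X$ occurs in exactly $\lambda$ blocks. A transversal design $\mathrm{TD}(k,n)$ is a triple $(X,\mathcal{G},\mathcal{B})$ where $X$ is a set of $kn$ points, $\mathcal{G}$ is a partition of $X$ into $k$ subsets of cardinality $n$ (the groups), and $\mathcal{B}$ is a set of $k$-element subsets of $X$ (the blocks) such that every pair of points not in the same group appears in exactly one block, and no block contains two points of the same group. Tic-Tac-Toe on a design: two players, Xeno (first) and Ophelia (second), alternately choose points not chosen before; the first player to have chosen all the points of some block wins. If all points are chosen and nobody has completed a block, the game is a draw. Only the blocks (not the groups) are winning sets. Ophelia "can force a draw" if she has a strategy guaranteeing that Xeno does not win. *)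

theory Defs
  imports Complex_Main "HOL-Library.Multiset" "HOL-Library.Disjoint_Sets"
begin

text \<open>
  A BIBD may have repeated blocks, hence the multiset. As \<open>card\<close> is \<open>0\<close> on infinite sets,
  finiteness of the point set is required separately.
\<close>

definition bibd :: "'a set \<Rightarrow> 'a set multiset \<Rightarrow> nat \<Rightarrow> nat \<Rightarrow> nat \<Rightarrow> bool" where
  "bibd X B v k l \<longleftrightarrow>
     finite X \<and> card X = v \<and>
     (\<forall>b\<in>#B. b \<subseteq> X \<and> card b = k) \<and>
     (\<forall>x\<in>X. \<forall>y\<in>X. x \<noteq> y \<longrightarrow> size {#b \<in># B. x \<in> b \<and> y \<in> b#} = l)"

definition transversal_design ::
  "'a set \<Rightarrow> 'a set set \<Rightarrow> 'a set set \<Rightarrow> nat \<Rightarrow> nat \<Rightarrow> bool" where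
  "transversal_design X G B k n \<longleftrightarrow>
     finite X \<and> card X = k * n \<and>
     partition_on X G \<and> card G = k \<and> (\<forall>g\<in>G. card g = n) \<and>
     (\<forall>b\<in>B. b \<subseteq> X \<and> card b = k) \<and>
     (\<forall>x\<in>X. \<forall>y\<in>X. (\<nexists>g. g \<in> G \<and> x \<in> g \<and> y \<in> g) \<longrightarrow> (\<exists>!b. b \<in> B \<and> x \<in> b \<and> y \<in> b)) \<and>
     (\<forall>b\<in>B. \<forall>g\<in>G. \<forall>x\<in>b \<inter> g. \<forall>y\<in>b \<inter> g. x = y)"

datatype player = Xeno | Ophelia

text \<open>
  A history of the game is the list of the points chosen so far, oldest first; the move
  with index \<open>i\<close> (counted from \<open>0\<close>) is made by \<open>mover i\<close>.
\<close>

definition mover :: "nat \<Rightarrow> player" where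
  "mover i = (if even i then Xeno else Ophelia)"

definition chosen :: "player \<Rightarrow> 'a list \<Rightarrow> 'a set" where
  "chosen p h = {h ! i | i. i < length h \<and> mover i = p}"

definition has_block :: "'a set set \<Rightarrow> player \<Rightarrow> 'a list \<Rightarrow> bool" where
  "has_block B p h \<longleftrightarrow> (\<exists>b\<in>B. b \<subseteq> chosen p h)"

definition moves_available :: "'a set \<Rightarrow> 'a set set \<Rightarrow> 'a list \<Rightarrow> bool" where
  "moves_available X B h \<longleftrightarrow> (\<forall>p. \<not> has_block B p h) \<and> X - set h \<noteq> {}"

text \<open>
  No move is made once a block has been completed. Hence in a legal history at most one player
  has a block, and that player completed it first.
\<close>

inductive legal_history :: "'a set \<Rightarrow> 'a set set \<Rightarrow> 'a list \<Rightarrow> bool" for X B where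
  start: "legal_history X B []"
| move: "legal_history X B h \<Longrightarrow> moves_available X B h \<Longrightarrow> x \<in> X - set h \<Longrightarrow>
    legal_history X B (h @ [x])"

definition wins :: "'a set \<Rightarrow> 'a set set \<Rightarrow> player \<Rightarrow> 'a list \<Rightarrow> bool" where
  "wins X B p h \<longleftrightarrow> legal_history X B h \<and> has_block B p h"

definition strategy :: "'a set \<Rightarrow> 'a set set \<Rightarrow> player \<Rightarrow> ('a list \<Rightarrow> 'a) \<Rightarrow> bool" where
  "strategy X B p s \<longleftrightarrow>
     (\<forall>h. legal_history X B h \<and> moves_available X B h \<and> mover (length h) = p \<longrightarrow>
          s h \<in> X - set h)"

definition follows :: "player \<Rightarrow> ('a list \<Rightarrow> 'a) \<Rightarrow> 'a list \<Rightarrow> bool" where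
  "follows p s h \<longleftrightarrow> (\<forall>i<length h. mover i = p \<longrightarrow> h ! i = s (take i h))"

text \<open>
  Forcing a draw means preventing a win of Xeno; histories in which Ophelia wins are allowed.
\<close>

definition ophelia_can_force_draw :: "'a set \<Rightarrow> 'a set set \<Rightarrow> bool" where
  "ophelia_can_force_draw X B \<longleftrightarrow>
     (\<exists>s. strategy X B Ophelia s \<and> (\<forall>h. follows Ophelia s h \<longrightarrow> \<not> wins X B Xeno h))"

end

theory Submission
  imports Defs
begin

text \<open>
  Ophelia's task is the breaker's side of a hypergraph game. A position with Ophelia to move is
  described by the blocks she has not hit yet, with Xeno's points deleted; Xeno has won when the
  empty block occurs. By Erdos and Selfridge, if the sum of \<open>2 ^ - |b|\<close> over these residual blocks
  \<open>b\<close> is below \<open>1\<close>, then Ophelia keeps it below \<open>1\<close> by always taking a point of maximal weight.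
  After Xeno's first move the sum is \<open>(|B| + r) / 2 ^ k\<close>, where \<open>r\<close> is the number of blocks
  through the first point, and double counting turns the bounds of (i) and (ii) into
  \<open>|B| + r < 2 ^ k\<close>.

  A \<open>TD(4,4)\<close> has \<open>|B| + r = 20\<close>, so this fails. But once the first point is labelled \<open>0\<close>, such a
  design is unique up to relabelling: Latin squares of order 4 with an orthogonal mate come from
  the field with four elements. On this single design an explicit greedy strategy, followed for at
  most five moves, brings the weight below \<open>1\<close>.
\<close>

section \<open>The breaker game on residual blocks\<close>

text \<open>
  Ophelia (to move) hits all blocks containing \<open>w\<close>, then Xeno deletes \<open>u\<close> from the others. Occupied
  points belong to no residual block, so playing them is merely a pass; this is why \<open>w\<close> and \<open>u\<close> need not be
  distinct from each other or from earlier choices.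
\<close>

coinductive breaker_wins :: "'a set set \<Rightarrow> bool" where
  reply: "{} \<notin> H \<Longrightarrow> (\<And>u. breaker_wins ((\<lambda>b. b - {u}) ` {b \<in> H. w \<notin> b})) \<Longrightarrow> breaker_wins H"

text \<open>Coinduction for an invariant \<open>P\<close> that one round preserves, freed from the
  equation and the disjunction of the raw rule.\<close>

lemma breaker_wins_coinductI:
  assumes "P H" "\<And>H. P H \<Longrightarrow> {} \<notin> H" "\<And>H. P H \<Longrightarrow> \<exists>w. \<forall>u. P ((\<lambda>b. b - {u}) ` {b \<in> H. w \<notin> b})"
  shows "breaker_wins H"
  using assms(1)
proof (rule breaker_wins.coinduct)
  fix H assume H: "P H"
  with assms(3) obtain w where "\<forall>u. P ((\<lambda>b. b - {u}) ` {b \<in> H. w \<notin> b})" by blast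
  with assms(2)[OF H]
  show "\<exists>H' w. H = H' \<and> {} \<notin> H' \<and> (\<forall>u. P ((\<lambda>b. b - {u}) ` {b \<in> H'. w \<notin> b}) \<or>
      breaker_wins ((\<lambda>b. b - {u}) ` {b \<in> H'. w \<notin> b}))"
    by (intro exI[of _ H] exI[of _ w]) simp
qed

text \<open>Ophelia plays on \<open>H\<close> by copying replies on \<open>K\<close> through
  \<open>l\<close>: a block of \<open>H\<close> whose image contains a block of \<open>K\<close> is
  hit whenever the smaller one is, and deleting a point keeps the containment. The invariant
  \<open>P\<close> says that such a \<open>K\<close> exists; injectivity pulls each reply back to a
  single point.\<close>

lemma breaker_wins_transfer:
  assumes "breaker_wins K" "inj_on l (\<Union>H)" "\<And>b. b \<in> H \<Longrightarrow> \<exists>c\<in>K. c \<subseteq> l ` b"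
  shows "breaker_wins H"
proof -
  define P where "P H \<longleftrightarrow> (\<exists>K. breaker_wins K \<and> inj_on l (\<Union>H) \<and> (\<forall>b\<in>H. \<exists>c\<in>K. c \<subseteq> l ` b))" for H
  have step: "{} \<notin> H \<and> (\<exists>w. \<forall>u. P ((\<lambda>b. b - {u}) ` {b \<in> H. w \<notin> b}))" if "P H" for H
  proof -
    from that obtain K where K: "breaker_wins K" and inj: "inj_on l (\<Union>H)"
      and dom: "\<forall>b\<in>H. \<exists>c\<in>K. c \<subseteq> l ` b"
      unfolding P_def by blast
    from K obtain w where ne: "{} \<notin> K"
      and w: "\<And>u. breaker_wins ((\<lambda>b. b - {u}) ` {b \<in> K. w \<notin> b})"
      by cases blast
    \<comment> \<open>If no point of \<open>H\<close> has label \<open>w\<close>, any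
      \<open>w'\<close> will do.\<close>
    obtain w' where w': "\<And>p. p \<in> \<Union>H \<Longrightarrow> l p = w \<Longrightarrow> p = w'"
      using inj by (metis inj_onD)
    have "{} \<notin> H" using dom ne by auto
    moreover have "P ((\<lambda>b. b - {u}) ` {b \<in> H. w' \<notin> b})" for u
      unfolding P_def
    proof (intro exI conjI)
      show "breaker_wins ((\<lambda>b. b - {l u}) ` {b \<in> K. w \<notin> b})" by (rule w)
      show "inj_on l (\<Union>((\<lambda>b. b - {u}) ` {b \<in> H. w' \<notin> b}))"
        by (rule inj_on_subset[OF inj]) auto
      show "\<forall>b\<in>(\<lambda>b. b - {u}) ` {b \<in> H. w' \<notin> b}. \<exists>c\<in>(\<lambda>b. b - {l u}) ` {b \<in> K. w \<notin> b}. c \<subseteq> l ` b"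
      proof
        fix b' assume "b' \<in> (\<lambda>b. b - {u}) ` {b \<in> H. w' \<notin> b}"
        then obtain b where b: "b' = b - {u}" "b \<in> H" "w' \<notin> b" by blast
        with dom obtain c where c: "c \<in> K" "c \<subseteq> l ` b" by blast
        have "w \<notin> c" using c(2) b w' by blast
        moreover have "c - {l u} \<subseteq> l ` b'" using c(2) b(1) by auto
        ultimately show "\<exists>c\<in>(\<lambda>b. b - {l u}) ` {b \<in> K. w \<notin> b}. c \<subseteq> l ` b'" using c(1) by blast
      qed
    qed
    ultimately show ?thesis by blast
  qed
  have "P H" unfolding P_def using assms by blast
  then show ?thesis by (rule breaker_wins_coinductI) (use step in blast)+
qed

text \<open>Dropping blocks or enlarging them only helps Ophelia.\<close>

lemma breaker_wins_dominated:
  assumes "breaker_wins K" "\<And>b. b \<in> H \<Longrightarrow> \<exists>c\<in>K. c \<subseteq> b"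
  shows "breaker_wins H"
  using breaker_wins_transfer[of K id H] assms by simp

text \<open>With \<open>W p\<close> the weight of the blocks through \<open>p\<close>, a reply
  \<open>w\<close> of maximal \<open>W\<close> removes \<open>W w\<close>. Deleting \<open>u\<close>
  doubles the weight of the remaining blocks through \<open>u\<close>, which adds at most
  \<open>W u \<le> W w\<close>. So the total never grows, and the empty block alone would weigh
  \<open>1\<close>.\<close>

lemma breaker_wins_Erdos_Selfridge:
  assumes "finite H" "\<And>b. b \<in> H \<Longrightarrow> finite b" "(\<Sum>b\<in>H. (1/2::real) ^ card b) < 1"
  shows "breaker_wins H"
proof -
  define P where "P H \<longleftrightarrow> finite H \<and> (\<forall>b\<in>H. finite b) \<and> (\<Sum>b\<in>H. (1/2::real) ^ card b) < 1"
    for H :: "'a set set"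
  have step: "{} \<notin> H \<and> (\<exists>w. \<forall>u. P ((\<lambda>b. b - {u}) ` {b \<in> H. w \<notin> b}))" if "P H" for H
  proof -
    from that have fin: "finite H" "\<And>b. b \<in> H \<Longrightarrow> finite b"
      and less: "(\<Sum>b\<in>H. (1/2::real) ^ card b) < 1" unfolding P_def by auto
    define W where "W p = (\<Sum>b\<in>{b\<in>H. p \<in> b}. (1/2::real) ^ card b)" for p
    have "\<exists>w. \<forall>p. W p \<le> W w"
    proof (cases "\<Union>H = {}")
      case True
      then have "{b\<in>H. p \<in> b} = {}" for p by blast
      then have "W p = 0" for p unfolding W_def by (metis sum.empty)
      then show ?thesis by simp
    next
      case False
      have finU: "finite (\<Union>H)" using fin by blast
      then have "Max (W ` \<Union>H) \<in> W ` \<Union>H" using False by (intro Max_in) auto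
      then obtain w where "Max (W ` \<Union>H) = W w" by blast
      then have w: "W p \<le> W w" if "p \<in> \<Union>H" for p
        using finU that by (metis Max_ge finite_imageI imageI)
      have "W p \<le> W w" for p
      proof (cases "p \<in> \<Union>H")
        case False
        then have "{b\<in>H. p \<in> b} = {}" by blast
        then have "W p = 0" unfolding W_def by (metis sum.empty)
        then show ?thesis by (simp add: W_def sum_nonneg)
      qed (use w in blast)
      then show ?thesis by blast
    qed
    then obtain w where w: "\<And>p. W p \<le> W w" by blast
    have "{} \<notin> H"
    proof
      assume "{} \<in> H"
      then have "(1/2::real) ^ card ({} :: 'a set) \<le> (\<Sum>b\<in>H. (1/2::real) ^ card b)"
        using fin(1) by (intro member_le_sum) auto
      with less show False by simp
    qed
    moreover have "(\<Sum>b\<in>(\<lambda>b. b - {u}) ` {b \<in> H. w \<notin> b}. (1/2::real) ^ card b) < 1" for u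
    proof -
      have half: "(1/2::real) ^ card (b - {u}) = (1/2) ^ card b + (if u \<in> b then (1/2) ^ card b else 0)"
        if "b \<in> H" for b
      proof (cases "u \<in> b")
        case True
        then obtain n where "card b = Suc n" "card (b - {u}) = n"
          using fin(2) \<open>b \<in> H\<close> card_Suc_Diff1[of b u] by metis
        then show ?thesis using True by simp
      qed simp
      \<comment> \<open>Blocks that coincide after the deletion are counted once on the left, hence
        only an inequality.\<close>
      have "(\<Sum>b\<in>(\<lambda>b. b - {u}) ` {b \<in> H. w \<notin> b}. (1/2::real) ^ card b)
          \<le> (\<Sum>b\<in>{b \<in> H. w \<notin> b}. (1/2) ^ card (b - {u}))"
        using sum_image_le[of "{b \<in> H. w \<notin> b}" "\<lambda>b. (1/2::real) ^ card b" "\<lambda>b. b - {u}"] fin(1)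
        by (simp add: o_def)
      also have "\<dots> = (\<Sum>b\<in>{b \<in> H. w \<notin> b}. (1/2) ^ card b)
          + (\<Sum>b\<in>{b \<in> H. w \<notin> b}. if u \<in> b then (1/2) ^ card b else 0)"
        using half by (simp add: sum.distrib)
      also have "(\<Sum>b\<in>{b \<in> H. w \<notin> b}. if u \<in> b then (1/2) ^ card b else 0) \<le> W u"
      proof -
        have "(\<Sum>b\<in>{b \<in> H. w \<notin> b}. if u \<in> b then (1/2::real) ^ card b else 0)
          \<le> (\<Sum>b\<in>H. if u \<in> b then (1/2) ^ card b else 0)"
          using fin(1) by (intro sum_mono2) auto
        also have "\<dots> = W u" unfolding W_def using fin(1) by (simp add: sum.inter_filter)
        finally show ?thesis .
      qed
      also have "W u \<le> W w" by (rule w)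
      also have "(\<Sum>b\<in>{b \<in> H. w \<notin> b}. (1/2) ^ card b) + W w = (\<Sum>b\<in>H. (1/2::real) ^ card b)"
      proof -
        have "H = {b \<in> H. w \<notin> b} \<union> {b \<in> H. w \<in> b}" by blast
        then show ?thesis unfolding W_def
          using sum.union_disjoint[of "{b \<in> H. w \<notin> b}" "{b \<in> H. w \<in> b}" "\<lambda>b. (1/2::real) ^ card b"] fin(1)
          by fastforce
      qed
      also note less
      finally show ?thesis by simp
    qed
    moreover have "finite ((\<lambda>b. b - {u}) ` {b \<in> H. w \<notin> b})"
      "\<forall>b\<in>(\<lambda>b. b - {u}) ` {b \<in> H. w \<notin> b}. finite b" for u
      using fin by auto
    ultimately show ?thesis unfolding P_def by blast
  qed
  have "P H" unfolding P_def using assms by blast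
  then show ?thesis by (rule breaker_wins_coinductI) (use step in blast)+
qed

section \<open>Playing on a design\<close>

lemma mover_neq [simp]: "mover n \<noteq> Xeno \<longleftrightarrow> mover n = Ophelia" "mover n \<noteq> Ophelia \<longleftrightarrow> mover n = Xeno"
  by (metis player.exhaust player.distinct(1))+

lemma mover_Suc: "mover (Suc n) = Xeno \<longleftrightarrow> mover n = Ophelia" "mover (Suc n) = Ophelia \<longleftrightarrow> mover n = Xeno"
  by (auto simp: mover_def)

lemma chosen_snoc:
  "chosen p (h @ [x]) = (if mover (length h) = p then insert x (chosen p h) else chosen p h)"
proof -
  have chosen_image: "chosen p h = (!) h ` {i. i < length h \<and> mover i = p}" for h :: "'a list"
    unfolding chosen_def by blast
  have "{i. i < Suc (length h) \<and> mover i = p} = (if mover (length h) = p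
      then insert (length h) {i. i < length h \<and> mover i = p} else {i. i < length h \<and> mover i = p})"
    by (auto simp: less_Suc_eq)
  moreover have "(!) (h @ [x]) ` {i. i < length h \<and> mover i = p} = (!) h ` {i. i < length h \<and> mover i = p}"
    by (intro image_cong) (auto simp: nth_append)
  ultimately show ?thesis unfolding chosen_image by simp
qed

lemma chosen_Nil [simp]: "chosen p [] = {}"
  by (simp add: chosen_def)

lemma set_eq_chosen: "set h = chosen Xeno h \<union> chosen Ophelia h"
proof (induction h rule: rev_induct)
  case (snoc x h)
  then show ?case by (cases "mover (length h)") (auto simp: chosen_snoc)
qed simp

lemma follows_snoc:
  "follows p s (h @ [x]) \<longleftrightarrow> follows p s h \<and> (mover (length h) = p \<longrightarrow> x = s h)"
  unfolding follows_def by (auto simp: nth_append less_Suc_eq)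

text \<open>An abstract reply may be an occupied point, whereas a strategy has to name a free one;
  apart from that, Ophelia follows the breaker. Along histories that follow \<open>s\<close>, the
  residual position is won for her after each move of Xeno, so it lacks the empty block and Xeno
  owns no block.\<close>

lemma ophelia_can_force_drawI:
  assumes ne: "{} \<notin> B" and sub: "\<And>b. b \<in> B \<Longrightarrow> b \<subseteq> X"
    and open1: "\<And>x. x \<in> X \<Longrightarrow> breaker_wins ((\<lambda>b. b - {x}) ` B)"
  shows "ophelia_can_force_draw X B"
proof -
  \<comment> \<open>\<open>R Y Z\<close> is the residual hypergraph when Xeno holds \<open>Y\<close>
    and Ophelia holds \<open>Z\<close>.\<close>
  define R where "R Y Z = (\<lambda>b. b - Y) ` {b \<in> B. b \<inter> Z = {}}" for Y Z
  define good where "good h w \<longleftrightarrow> w \<in> X - set h \<and>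
    (\<forall>u\<in>X - set h. breaker_wins (R (insert u (chosen Xeno h)) (insert w (chosen Ophelia h))))" for h w
  \<comment> \<open>The second choice keeps \<open>s\<close> legal at histories without a good
    point.\<close>
  define s where "s h = (if \<exists>w. good h w then SOME w. good h w else SOME w. w \<in> X - set h)" for h
  have good: "\<exists>w. good h w"
    if bw: "breaker_wins (R (chosen Xeno h) (chosen Ophelia h))" and av: "moves_available X B h" for h
  proof -
    let ?Y = "chosen Xeno h" and ?Z = "chosen Ophelia h"
    from bw obtain w where w: "\<And>u. breaker_wins ((\<lambda>b. b - {u}) ` {b \<in> R ?Y ?Z. w \<notin> b})"
      by cases blast
    \<comment> \<open>If \<open>w\<close> is not free, any free point serves: residual blocks
      consist of free points, so none of them contains \<open>w\<close>.\<close>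
    from av obtain w' where w': "w' \<in> X - set h" "w \<in> X - set h \<Longrightarrow> w' = w"
      unfolding moves_available_def by blast
    have "breaker_wins (R (insert u ?Y) (insert w' ?Z))" for u
    proof (rule breaker_wins_dominated[OF w[of u]])
      fix b' assume "b' \<in> R (insert u ?Y) (insert w' ?Z)"
      then obtain b where b: "b' = b - insert u ?Y" "b \<in> B" "b \<inter> insert w' ?Z = {}"
        unfolding R_def by blast
      then have "w \<notin> b - ?Y" using w' sub[OF b(2)] set_eq_chosen[of h] by blast
      then have "b - ?Y - {u} \<in> (\<lambda>b. b - {u}) ` {b \<in> R ?Y ?Z. w \<notin> b}"
        using b unfolding R_def by blast
      then show "\<exists>c\<in>(\<lambda>b. b - {u}) ` {b \<in> R ?Y ?Z. w \<notin> b}. c \<subseteq> b'"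
        using b(1) by (intro bexI[of _ "b - ?Y - {u}"]) auto
    qed
    then show ?thesis unfolding good_def using w'(1) by blast
  qed
  have s_good: "good h (s h)" if "\<exists>w. good h w" for h
    unfolding s_def using that by (simp add: someI_ex)
  have strat: "strategy X B Ophelia s"
    unfolding strategy_def
  proof (intro allI impI)
    fix h assume "legal_history X B h \<and> moves_available X B h \<and> mover (length h) = Ophelia"
    then have ex: "\<exists>w. w \<in> X - set h" unfolding moves_available_def by blast
    show "s h \<in> X - set h"
    proof (cases "\<exists>w. good h w")
      case True
      then show ?thesis using s_good unfolding good_def by blast
    next
      case False
      then show ?thesis unfolding s_def using someI_ex[OF ex] by (simp only: if_False)
    qed
  qed
  \<comment> \<open>When Xeno is to move on a full board, the statement about his next points is
    vacuous; so the absence of a block of his is carried separately.\<close>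
  have inv: "chosen Xeno h \<inter> chosen Ophelia h = {} \<and>
      (if mover (length h) = Ophelia then breaker_wins (R (chosen Xeno h) (chosen Ophelia h))
       else \<not> has_block B Xeno h \<and>
         (\<forall>u\<in>X - set h. breaker_wins (R (insert u (chosen Xeno h)) (chosen Ophelia h))))"
    if "legal_history X B h" "follows Ophelia s h" for h
    using that
  proof induction
    case start
    have "R {u} {} = (\<lambda>b. b - {u}) ` B" for u by (auto simp: R_def)
    then show ?case using ne open1 by (auto simp: has_block_def mover_def)
  next
    case (move h x)
    then have IH: "chosen Xeno h \<inter> chosen Ophelia h = {}" 
      "(if mover (length h) = Ophelia then breaker_wins (R (chosen Xeno h) (chosen Ophelia h))
       else \<not> has_block B Xeno h \<and>
         (\<forall>u\<in>X - set h. breaker_wins (R (insert u (chosen Xeno h)) (chosen Ophelia h))))"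
      by (auto simp: follows_snoc)
    have x: "x \<notin> chosen Xeno h" "x \<notin> chosen Ophelia h" using move.hyps set_eq_chosen[of h] by auto
    show ?case
    proof (cases "mover (length h) = Ophelia")
      case True
      then have "x = s h" using move.prems by (simp add: follows_snoc)
      then have "good h x" using s_good good IH True move.hyps(2) by auto
      moreover have "\<not> has_block B Xeno h" using move.hyps(2) by (simp add: moves_available_def)
      ultimately show ?thesis using True IH x
        by (auto simp: chosen_snoc mover_def good_def has_block_def)
    next
      case False
      then show ?thesis using IH x move.hyps(3)
        by (auto simp: chosen_snoc mover_Suc)
    qed
  qed
  have "\<not> wins X B Xeno h" if "follows Ophelia s h" for h
  proof
    assume "wins X B Xeno h"
    then have lh: "legal_history X B h" "has_block B Xeno h" by (auto simp: wins_def)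
    note i = inv[OF lh(1) that]
    then have "breaker_wins (R (chosen Xeno h) (chosen Ophelia h))"
      using lh(2) by (auto split: if_splits)
    then have "{} \<notin> R (chosen Xeno h) (chosen Ophelia h)" by cases
    moreover obtain b where "b \<in> B" "b \<subseteq> chosen Xeno h" using lh(2) by (auto simp: has_block_def)
    ultimately show False using i unfolding R_def by blast
  qed
  then show ?thesis unfolding ophelia_can_force_draw_def using strat by blast
qed

text \<open>Blocks through \<open>x\<close> are disjoint outside \<open>x\<close>, so their number
  \<open>r x\<close> satisfies \<open>r x * (k - 1) \<le> d\<close>, and summing over all points
  gives \<open>card B * k * (k - 1) \<le> card X * d\<close>. With \<open>less\<close> this yields
  \<open>card B + r x < 2 ^ k\<close>, the Erdos-Selfridge condition after Xeno's first move
  \<open>x\<close>. The parameter \<open>d\<close> lets one count serve both families of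
  designs.\<close>

lemma partial_linear_space_draw:
  assumes fin: "finite X" and sub: "\<And>b. b \<in> B \<Longrightarrow> b \<subseteq> X \<and> card b = k" and k: "k \<ge> 2"
    and lin: "\<And>b c x y. \<lbrakk>b \<in> B; c \<in> B; x \<noteq> y; x \<in> b; y \<in> b; x \<in> c; y \<in> c\<rbrakk> \<Longrightarrow> b = c"
    and deg: "\<And>x. x \<in> X \<Longrightarrow> card {y \<in> X - {x}. \<exists>b\<in>B. x \<in> b \<and> y \<in> b} \<le> d"
    and less: "d * (card X + k) < k * (k - 1) * 2 ^ k"
  shows "ophelia_can_force_draw X B"
proof (rule ophelia_can_force_drawI)
  have finB: "finite B" using fin sub by (metis PowI finite_Pow_iff finite_subset subsetI)
  have finb: "finite b" if "b \<in> B" for b using sub[OF that] fin finite_subset by blast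
  show "{} \<notin> B" using sub k by fastforce
  show "b \<subseteq> X" if "b \<in> B" for b using sub that by blast
  define r where "r x = card {b\<in>B. x \<in> b}" for x
  have r: "r x * (k - 1) \<le> d" if x: "x \<in> X" for x
  proof -
    have "r x * (k - 1) = (\<Sum>b\<in>{b\<in>B. x \<in> b}. card (b - {x}))"
      unfolding r_def using sub finb by simp
    also have "\<dots> = card (\<Union>b\<in>{b\<in>B. x \<in> b}. b - {x})"
    proof (rule card_UN_disjoint[symmetric])
      show "\<forall>b\<in>{b\<in>B. x \<in> b}. \<forall>c\<in>{b\<in>B. x \<in> b}. b \<noteq> c \<longrightarrow> (b - {x}) \<inter> (c - {x}) = {}"
        using lin by blast
    qed (use finB finb in auto)
    also have "\<dots> \<le> card {y \<in> X - {x}. \<exists>b\<in>B. x \<in> b \<and> y \<in> b}"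
      using fin sub by (intro card_mono) auto
    finally show ?thesis using deg[OF x] by linarith
  qed
  \<comment> \<open>Incidences of points and blocks are counted in two ways.\<close>
  have "card B * k = (\<Sum>b\<in>B. \<Sum>x\<in>X. if x \<in> b then 1 else 0)"
  proof -
    have "(\<Sum>x\<in>X. if x \<in> b then 1 else 0 :: nat) = k" if "b \<in> B" for b
      using sub[OF that] fin by (simp add: sum.If_cases Int_absorb1)
    then show ?thesis by simp
  qed
  also have "\<dots> = (\<Sum>x\<in>X. r x)"
    unfolding r_def using finB by (subst sum.swap) (simp add: sum.If_cases Int_def)
  finally have "card B * k * (k - 1) = (\<Sum>x\<in>X. r x * (k - 1))" by (simp add: sum_distrib_right)
  also have "\<dots> \<le> card X * d" using r sum_bounded_above[of X "\<lambda>x. r x * (k - 1)" d] by simp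
  finally have cB: "card B * k * (k - 1) \<le> card X * d" .
  show "breaker_wins ((\<lambda>b. b - {x}) ` B)" if x: "x \<in> X" for x
  proof (rule breaker_wins_Erdos_Selfridge)
    have "(card B + r x) * (k * (k - 1)) \<le> card X * d + k * d"
      using cB mult_le_mono2[OF r[OF x], of k] by (simp add: algebra_simps)
    also have "\<dots> < 2 ^ k * (k * (k - 1))" using less by (simp add: algebra_simps)
    finally have lt: "card B + r x < 2 ^ k" by simp
    \<comment> \<open>Blocks through \<open>x\<close> have doubled weight, so they count once in
      \<open>card B\<close> and once more in \<open>r x\<close>.\<close>
    have w: "(1/2::real) ^ card (b - {x}) = (1/2) ^ k + (if x \<in> b then (1/2) ^ k else 0)" if "b \<in> B" for b
    proof -
      obtain m where m: "k = Suc m" using k by (cases k) auto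
      show ?thesis using sub[OF that] finb[OF that] m by (auto simp: card_Diff_singleton_if)
    qed
    have "(\<Sum>b\<in>(\<lambda>b. b - {x}) ` B. (1/2::real) ^ card b) \<le> (\<Sum>b\<in>B. (1/2) ^ card (b - {x}))"
      using sum_image_le[of B "\<lambda>b. (1/2::real) ^ card b" "\<lambda>b. b - {x}"] finB by (simp add: o_def)
    also have "\<dots> = real (card B + r x) * (1/2) ^ k"
      using w finB unfolding r_def
      by (simp add: sum.distrib sum.If_cases Int_def algebra_simps)
    also have "\<dots> < 1"
    proof -
      have "real (card B + r x) < 2 ^ k" using lt by (metis of_nat_less_iff of_nat_numeral of_nat_power)
      then show ?thesis by (simp add: power_one_over divide_simps)
    qed
    finally show "(\<Sum>b\<in>(\<lambda>b. b - {x}) ` B. (1/2::real) ^ card b) < 1" .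
  qed (use finB finb in auto)
qed

text \<open>Squaring the bound gives \<open>(2 * v + k - 1)^2 < D\<close>; subtracting
  \<open>(k - 1)^2\<close> and \<open>4 * k\<close> and dividing by 4 leaves
  \<open>(v - 1) * (v + k) < k * (k - 1) * 2 ^ k\<close>, the counting condition for
  \<open>d = v - 1\<close>.\<close>

lemma bibd_draw:
  assumes bibd: "bibd X B v k 1" and k: "k \<ge> 2"
    and less: "real v < (- real k + 1
                 + sqrt ((real k + 1)^2 + real k * (real k - 1) * 2 ^ (k + 2))) / 2"
  shows "ophelia_can_force_draw X (set_mset B)"
proof (rule partial_linear_space_draw[where k = k and d = "v - 1"])
  have X: "finite X" "card X = v" and blk: "\<And>b. b \<in># B \<Longrightarrow> b \<subseteq> X \<and> card b = k"
    and pair: "\<And>x y. x \<in> X \<Longrightarrow> y \<in> X \<Longrightarrow> x \<noteq> y \<Longrightarrow> size {#b \<in># B. x \<in> b \<and> y \<in> b#} = 1"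
    using bibd unfolding bibd_def by auto
  show "finite X" "k \<ge> 2" "\<And>b. b \<in># B \<Longrightarrow> b \<subseteq> X \<and> card b = k" by (fact X k blk)+
  show "b = c" if "b \<in># B" "c \<in># B" "x \<noteq> y" "x \<in> b" "y \<in> b" "x \<in> c" "y \<in> c" for b c x y
  proof -
    have "size {#b \<in># B. x \<in> b \<and> y \<in> b#} = 1" using pair blk that by blast
    then obtain a where "{#b \<in># B. x \<in> b \<and> y \<in> b#} = {#a#}" by (metis One_nat_def size_1_singleton_mset)
    moreover have "b \<in># {#b \<in># B. x \<in> b \<and> y \<in> b#}" "c \<in># {#b \<in># B. x \<in> b \<and> y \<in> b#}"
      using that by auto
    ultimately show "b = c" by auto
  qed
  show "card {y \<in> X - {x}. \<exists>b\<in>#B. x \<in> b \<and> y \<in> b} \<le> v - 1" if "x \<in> X" for x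
    using X that card_mono[of "X - {x}" "{y \<in> X - {x}. \<exists>b\<in>#B. x \<in> b \<and> y \<in> b}"] by auto
  show "(v - 1) * (card X + k) < k * (k - 1) * 2 ^ k"
  \<comment> \<open>The truncated difference \<open>v - 1\<close> agrees with the real one only for
    positive \<open>v\<close>.\<close>
  proof (cases "v = 0")
    case True
    then show ?thesis using k by simp
  next
    case False
    define D where "D = (real k + 1)^2 + real k * (real k - 1) * 2 ^ (k + 2)"
    have "2 * real v + real k - 1 < sqrt D" using less unfolding D_def by simp
    moreover have "0 \<le> 2 * real v + real k - 1" using k by simp
    ultimately have "(2 * real v + real k - 1)\<^sup>2 < (sqrt D)\<^sup>2" by (intro power_strict_mono) auto
    also have "(sqrt D)\<^sup>2 = D" unfolding D_def using k by simp
    finally have "(2 * real v + real k - 1)\<^sup>2 < D" .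
    then have "(real v - 1) * (real v + real k) < real k * (real k - 1) * 2 ^ k"
      unfolding D_def by (simp add: power2_eq_square algebra_simps)
    moreover have "real (v - 1) = real v - 1" "real (k - 1) = real k - 1" using False k by auto
    ultimately have "real ((v - 1) * (v + k)) < real (k * (k - 1) * 2 ^ k)" by simp
    then show ?thesis using X(2) by (metis of_nat_less_iff)
  qed
qed

section \<open>Transversal designs with small groups\<close>

lemma transversal_designD:
  assumes "transversal_design X G B k n"
  shows "finite X" "card X = k * n" "partition_on X G" "card G = k"
    and "\<And>g. g \<in> G \<Longrightarrow> card g = n"
    and "\<And>b. b \<in> B \<Longrightarrow> b \<subseteq> X" "\<And>b. b \<in> B \<Longrightarrow> card b = k"
    and "\<And>b g x y. \<lbrakk>b \<in> B; g \<in> G; x \<in> b; x \<in> g; y \<in> b; y \<in> g\<rbrakk> \<Longrightarrow> x = y"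
    and "\<And>x y. \<lbrakk>x \<in> X; y \<in> X; \<nexists>g. g \<in> G \<and> x \<in> g \<and> y \<in> g\<rbrakk> \<Longrightarrow> \<exists>!b. b \<in> B \<and> x \<in> b \<and> y \<in> b"
  using assms unfolding transversal_design_def by (elim conjE; simp)+

lemma transversal_design_block_unique:
  assumes td: "transversal_design X G B k n"
    and b: "b \<in> B" "c \<in> B" and xy: "x \<noteq> y" "x \<in> b" "y \<in> b" "x \<in> c" "y \<in> c"
  shows "b = c"
proof -
  have "x \<in> X" "y \<in> X" using transversal_designD(6)[OF td] b xy by blast+
  moreover have "\<nexists>g. g \<in> G \<and> x \<in> g \<and> y \<in> g"
    using transversal_designD(8)[OF td b(1)] xy by blast
  ultimately have "\<exists>!b. b \<in> B \<and> x \<in> b \<and> y \<in> b" by (rule transversal_designD(9)[OF td])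
  then show ?thesis using b xy by blast
qed

text \<open>A point shares blocks only with points outside its group, whence
  \<open>d = k * n - n\<close>, and the counting condition reduces to
  \<open>n * (n + 1) < 2 ^ k\<close>.\<close>

lemma transversal_design_draw:
  assumes td: "transversal_design X G B k n" and k: "k \<ge> 2"
    and le: "real n \<le> 2 powr (real k / 2) - 1 / 2"
  shows "ophelia_can_force_draw X B"
proof (rule partial_linear_space_draw[where k = k and d = "k * n - n"])
  have X: "finite X" "card X = k * n" and part: "partition_on X G" and grp: "\<And>g. g \<in> G \<Longrightarrow> card g = n"
    and blk: "\<And>b. b \<in> B \<Longrightarrow> b \<subseteq> X \<and> card b = k"
    using transversal_designD[OF td] by blast+
  show "finite X" "k \<ge> 2" "\<And>b. b \<in> B \<Longrightarrow> b \<subseteq> X \<and> card b = k" by (fact X k blk)+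
  show "b = c" if "b \<in> B" "c \<in> B" "x \<noteq> y" "x \<in> b" "y \<in> b" "x \<in> c" "y \<in> c" for b c x y
    using transversal_design_block_unique[OF td that] .
  show "card {y \<in> X - {x}. \<exists>b\<in>B. x \<in> b \<and> y \<in> b} \<le> k * n - n" if x: "x \<in> X" for x
  proof -
    obtain g where g: "g \<in> G" "x \<in> g" "g \<subseteq> X" using part x unfolding partition_on_def by blast
    have "card {y \<in> X - {x}. \<exists>b\<in>B. x \<in> b \<and> y \<in> b} \<le> card (X - g)"
      using X(1) transversal_designD(8)[OF td _ g(1)] g(2) by (intro card_mono) auto
    also have "\<dots> = k * n - n" using X g grp by (simp add: card_Diff_subset finite_subset)
    finally show ?thesis .
  qed
  show "(k * n - n) * (card X + k) < k * (k - 1) * 2 ^ k"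
  proof -
    have "(real n + 1/2)\<^sup>2 \<le> (2 powr (real k / 2))\<^sup>2" using le by (intro power_mono) auto
    also have "\<dots> = 2 ^ k" by (simp add: powr_power powr_realpow)
    \<comment> \<open>Since \<open>n * (n + 1) = (n + 1/2)^2 - 1/4\<close>, the inequality becomes
      strict.\<close>
    finally have "real (n * (n + 1)) < real (2 ^ k)" by (simp add: power2_eq_square algebra_simps)
    then have "n * (n + 1) < 2 ^ k" by (metis of_nat_less_iff)
    moreover have "(k * n - n) * (card X + k) = k * (k - 1) * (n * (n + 1))"
    proof -
      have "k * n - n = (k - 1) * n" by (simp add: diff_mult_distrib)
      then show ?thesis using X(2) by (simp add: algebra_simps)
    qed
    moreover have "0 < k * (k - 1)" using k by simp
    ultimately show ?thesis by (metis mult_less_mono2)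
  qed
qed

section \<open>A certified greedy strategy\<close>

text \<open>Sixteen times the Erdos-Selfridge weight, for blocks of size at most 4.\<close>

fun danger :: "'a list \<Rightarrow> int" where
  "danger [] = 16" | "danger [_] = 8" | "danger [_, _] = 4" | "danger [_, _, _] = 2" | "danger _ = 1"

text \<open>
  The weights \<open>1, 3, 4, 100\<close> were found by experiment: unlike those of the Erdos-Selfridge
  potential, they make the greedy reply succeed. Nothing below depends on them except the final
  evaluation.
\<close>

fun reply_value :: "'a list \<Rightarrow> int" where
  "reply_value [_] = 100" | "reply_value [_, _] = 4" | "reply_value [_, _, _] = 3" | "reply_value _ = 1"

text \<open>\<open>m\<close> and \<open>w\<close> hold the best value so far and its point; ties go
  to the earlier point.\<close>

fun best_reply :: "int list list \<Rightarrow> int list \<Rightarrow> int \<Rightarrow> int \<Rightarrow> int" where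
  "best_reply F [] m w = w"
| "best_reply F (p # ps) m w =
    (let m' = sum_list (map reply_value (filter (\<lambda>c. p \<in> set c) F))
     in if m < m' then best_reply F ps m' p else best_reply F ps m w)"

definition after_reply :: "int list list \<Rightarrow> int list list" where
  "after_reply F = (let w = best_reply F [0..15] 0 0 in filter (\<lambda>c. w \<notin> set c) F)"

text \<open>A search of depth \<open>n\<close> through Xeno's moves against the greedy replies; a
  branch ends as soon as Erdos-Selfridge applies. Only points of the remaining blocks are tried,
  since any other point is a pass.\<close>

fun survives :: "nat \<Rightarrow> int list list \<Rightarrow> bool" where
  "survives 0 F \<longleftrightarrow> sum_list (map danger F) < 16"
| "survives (Suc n) F \<longleftrightarrow> sum_list (map danger F) < 16 \<or> [] \<notin> set F \<and>
     (let G = after_reply F in \<forall>v\<in>set (remdups (concat G)). survives n (map (removeAll v) G))"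

text \<open>Equality holds up to length 4; longer lists are overestimated.\<close>

lemma danger_ge: "16 * (1/2) ^ length c \<le> real_of_int (danger c)"
proof (cases c rule: danger.cases)
  case (5 a b d e c')
  have "(1/2::real) ^ length c' \<le> 1" by (simp add: power_le_one)
  then show ?thesis using 5 by simp
qed simp_all

text \<open>Repeated lists, or lists with the same set of points, count several times in the integer
  sum and so only enlarge it.\<close>

lemma breaker_wins_if_danger:
  assumes dist: "\<And>c. c \<in> set F \<Longrightarrow> distinct c" and less: "sum_list (map danger F) < 16"
  shows "breaker_wins (set ` set F)"
proof (rule breaker_wins_Erdos_Selfridge)
  have "(\<Sum>b\<in>set ` set F. (1/2::real) ^ card b) \<le> (\<Sum>c\<in>set F. (1/2) ^ card (set c))"
    using sum_image_le[of "set F" "\<lambda>b. (1/2::real) ^ card b" set] by (simp add: o_def)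
  also have "\<dots> = (\<Sum>c\<in>set F. (1/2) ^ length c)"
    using dist by (simp add: distinct_card)
  also have "\<dots> \<le> (\<Sum>c\<leftarrow>F. (1/2) ^ length c)"
  proof (induction F)
    case (Cons c F)
    then show ?case by (cases "c \<in> set F") (simp_all add: insert_absorb add_increasing)
  qed simp
  also have "16 * \<dots> \<le> real_of_int (sum_list (map danger F))"
  proof (induction F)
    case (Cons c F)
    then show ?case using danger_ge[of c] by (simp add: algebra_simps)
  qed simp
  finally show "(\<Sum>b\<in>set ` set F. (1/2::real) ^ card b) < 1" using less by simp
qed auto

text \<open>The search certifies a reply against every point in a remaining block. A pass of Xeno is
  covered by monotonicity: deleting some point instead would leave smaller blocks.\<close>

lemma breaker_wins_if_survives:
  assumes "survives n F" "\<And>c. c \<in> set F \<Longrightarrow> distinct c"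
  shows "breaker_wins (set ` set F)"
  using assms
proof (induction n arbitrary: F)
  case 0
  then show ?case by (auto intro: breaker_wins_if_danger)
next
  case (Suc n)
  show ?case
  proof (cases "sum_list (map danger F) < 16")
    case True
    then show ?thesis using Suc.prems(2) by (rule breaker_wins_if_danger[rotated])
  next
    case False
    define w where "w = best_reply F [0..15] 0 0"
    define G where "G = filter (\<lambda>c. w \<notin> set c) F"
    have "after_reply F = G" unfolding after_reply_def G_def w_def Let_def by simp
    with False Suc.prems(1) have ne: "[] \<notin> set F"
      and sv: "\<And>v. v \<in> set (concat G) \<Longrightarrow> survives n (map (removeAll v) G)"
      by (auto simp: Let_def)
    have G: "{b \<in> set ` set F. w \<notin> b} = set ` set G" unfolding G_def by auto
    have step: "breaker_wins ((\<lambda>b. b - {v}) ` set ` set G)" if "v \<in> set (concat G)" for v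
    proof -
      have "distinct c" if "c \<in> set (map (removeAll v) G)" for c
        using that Suc.prems(2) unfolding G_def by (auto simp: distinct_removeAll)
      from Suc.IH[OF sv[OF that] this] have "breaker_wins (set ` set (map (removeAll v) G))" .
      then show ?thesis by (simp add: image_image)
    qed
    have "breaker_wins ((\<lambda>b. b - {u}) ` set ` set G)" for u
    proof (cases "u \<in> set (concat G)")
      case False
      show ?thesis
      \<comment> \<open>If no point remains, then no block remains either, because the empty one is
        excluded.\<close>
      proof (cases "set (concat G) = {}")
        case True
        have "c \<notin> set G" for c
        proof
          assume c: "c \<in> set G"
          with True have "c = []" by auto
          with c ne show False unfolding G_def by simp
        qed
        then have "G = []" by (cases G) auto
        then show ?thesis using breaker_wins_if_danger[of "[]"] by simp
      next
        case ne': False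
        then obtain v where v: "v \<in> set (concat G)" by (meson ex_in_conv)
        show ?thesis
        proof (rule breaker_wins_dominated[OF step[OF v]])
          fix b assume "b \<in> (\<lambda>b. b - {u}) ` set ` set G"
          then obtain c where c: "c \<in> set G" "b = set c - {u}" by blast
          then have "set c - {v} \<subseteq> b" using False by auto
          then show "\<exists>c\<in>(\<lambda>b. b - {v}) ` set ` set G. c \<subseteq> b" using c(1) by blast
        qed
      qed
    qed (rule step)
    moreover have "{} \<notin> set ` set F" using ne by auto
    ultimately show ?thesis using breaker_wins.reply[of "set ` set F" w] unfolding G by blast
  qed
qed

text \<open>
  The point \<open>4 * r + c\<close> is the element \<open>c\<close> of group \<open>r\<close>. With \<open>c\<close> read as an element of
  \<open>GF(4) = {0, 1, w, w + 1}\<close>, the blocks are \<open>(i, j, i + j, w * i + j)\<close>.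
\<close>

definition blocks :: "int list list" where "blocks =
 [[0,4,8,12],[0,5,9,13],[0,6,10,14],[0,7,11,15],
  [1,4,9,14],[1,5,8,15],[1,6,11,12],[1,7,10,13],
  [2,4,10,15],[2,5,11,14],[2,6,8,13],[2,7,9,12],
  [3,4,11,13],[3,5,10,12],[3,6,9,15],[3,7,8,14]]"

text \<open>Xeno's first point is \<open>0\<close>. It leaves four blocks of size 3 and twelve of
  size 4, of total danger 20, so the search has to go below the root.\<close>

lemma survives_blocks: "survives 5 (map (removeAll 0) blocks)"
  by code_simp

section \<open>Orthogonal Latin squares of order 4\<close>

definition perms :: "int list list" where
  "perms = filter distinct (List.n_lists 4 [0,1,2,3])"

text \<open>
  The pair \<open>p\<close> consists of the corresponding rows of two Latin squares, and \<open>q\<close> of another such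
  pair of rows; the last conjunct is orthogonality.
\<close>

definition row_ok :: "int list \<times> int list \<Rightarrow> int list \<times> int list \<Rightarrow> bool" where
  "row_ok p q \<longleftrightarrow> list_all2 (\<noteq>) (fst p) (fst q) \<and> list_all2 (\<noteq>) (snd p) (snd q) \<and>
     (\<forall>t\<in>set (zip (fst q) (snd q)). t \<notin> set (zip (fst p) (snd p)))"

lemma row_ok_map:
  "row_ok (map f xs, map g xs) (map f' xs, map g' xs) \<longleftrightarrow>
    (\<forall>x\<in>set xs. f x \<noteq> f' x \<and> g x \<noteq> g' x) \<and>
    (\<forall>x\<in>set xs. \<forall>y\<in>set xs. (f' x, g' x) \<noteq> (f y, g y))"
  unfolding row_ok_def fst_conv snd_conv list_all2_map1 list_all2_map2 list.rel_map list_all2_same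
    zip_map_map zip_same_conv_map set_map by fastforce

text \<open>The candidates for row \<open>i\<close> of a normalised pair of squares: row 0 is
  \<open>0, 1, 2, 3\<close> in both squares, and so is the first column of the first square.\<close>

definition rows :: "int \<Rightarrow> (int list \<times> int list) list" where
  "rows i = filter (\<lambda>p. hd (fst p) = i \<and> row_ok ([0,1,2,3], [0,1,2,3]) p) (List.product perms perms)"

text \<open>Exhaustive search. In \<open>GF(4)\<close>, the first square is \<open>i + j\<close> in
  both solutions; the second is \<open>w * i + j\<close> or \<open>w^2 * i + j\<close>.\<close>

lemma rows_cases:
  "\<forall>r1\<in>set (rows 1). \<forall>r2\<in>set (filter (row_ok r1) (rows 2)).
   \<forall>r3\<in>set (filter (\<lambda>r. row_ok r1 r \<and> row_ok r2 r) (rows 3)).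
     [r1, r2, r3] = [([1,0,3,2],[2,3,0,1]), ([2,3,0,1],[3,2,1,0]), ([3,2,1,0],[1,0,3,2])] \<or>
     [r1, r2, r3] = [([1,0,3,2],[3,2,1,0]), ([2,3,0,1],[1,0,3,2]), ([3,2,1,0],[2,3,0,1])]"
  by code_simp

text \<open>Here \<open>q r b\<close> is the label of the point of block \<open>b\<close> in group
  \<open>r\<close>. With \<open>q 0\<close> as row and \<open>q 1\<close> as column,
  \<open>q 2\<close> and \<open>q 3\<close> are the entries of two orthogonal Latin squares, which
  \<open>n0\<close> and \<open>n1\<close> normalise, so \<open>rows_cases\<close> applies. The
  condition \<open>f 0 = 0\<close> preserves the label of Xeno's first point.\<close>

lemma orthogonal_array_4:
  fixes q :: "nat \<Rightarrow> 'b \<Rightarrow> int"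
  assumes ran: "\<And>b r. b \<in> B \<Longrightarrow> r < 4 \<Longrightarrow> q r b \<in> {0..3}"
    and ex: "\<And>i j. i \<in> {0..3} \<Longrightarrow> j \<in> {0..3} \<Longrightarrow> \<exists>b\<in>B. q 0 b = i \<and> q 1 b = j"
    and eq: "\<And>b c r s. \<lbrakk>b \<in> B; c \<in> B; r < 4; s < 4; r \<noteq> s; q r b = q r c; q s b = q s c\<rbrakk> \<Longrightarrow> b = c"
    and n0: "\<And>b. b \<in> B \<Longrightarrow> q 0 b = 0 \<Longrightarrow> q 2 b = q 1 b \<and> q 3 b = q 1 b"
    and n1: "\<And>b. b \<in> B \<Longrightarrow> q 1 b = 0 \<Longrightarrow> q 2 b = q 0 b"
  shows "\<exists>f. bij_betw f {0..3} {0..3} \<and> f 0 = (0::int) \<and>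
    (\<forall>b\<in>B. [f (q 0 b), 4 + f (q 1 b), 8 + f (q 2 b), 12 + f (q 3 b)] \<in> set blocks)"
proof -
  define D where "D = {0..3::int}"
  note ran = ran[folded D_def] and ex = ex[folded D_def]
  have D_set: "D = set [0,1,2,3]" unfolding D_def by auto
  then have D_elems: "0 \<in> D" "1 \<in> D" "2 \<in> D" "3 \<in> D" by simp_all
  \<comment> \<open>\<open>b i j\<close> is the block belonging to the cell in row \<open>i\<close>
    and column \<open>j\<close>.\<close>
  obtain b where b: "\<And>i j. i \<in> D \<Longrightarrow> j \<in> D \<Longrightarrow> b i j \<in> B \<and> q 0 (b i j) = i \<and> q 1 (b i j) = j"
    using ex by metis
  have surj: "b (q 0 c) (q 1 c) = c" if "c \<in> B" for c
    using eq[of "b (q 0 c) (q 1 c)" c 0 1] b[OF ran[of c 0] ran[of c 1]] that by simp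
  have inj: "i = i' \<and> j = j'"
    if "i \<in> D" "j \<in> D" "i' \<in> D" "j' \<in> D" "b i j = b i' j'" for i j i' j'
    using b that by metis
  have b_eq: "i = i' \<and> j = j'"
    if ij: "i \<in> D" "j \<in> D" "i' \<in> D" "j' \<in> D"
      and rs: "r < 4" "s < 4" "r \<noteq> s" "q r (b i j) = q r (b i' j')" "q s (b i j) = q s (b i' j')"
    for i j i' j' r s
    using inj[OF ij] eq[OF _ _ rs] b[OF ij(1,2)] b[OF ij(3,4)] by blast
  define row where "row i = (map (\<lambda>j. q 2 (b i j)) [0,1,2,3], map (\<lambda>j. q 3 (b i j)) [0,1,2,3])" for i
  have row0: "row 0 = ([0,1,2,3], [0,1,2,3])"
  proof -
    have "q 2 (b 0 j) = j" "q 3 (b 0 j) = j" if "j \<in> D" for j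
      using n0[of "b 0 j"] b[OF D_elems(1) that] by simp_all
    then show ?thesis unfolding row_def D_set by simp
  qed
  have perm: "map (\<lambda>j. q r (b i j)) [0,1,2,3] \<in> set perms" if i: "i \<in> D" and r: "r = 2 \<or> r = 3" for i r
  proof -
    have "inj_on (\<lambda>j. q r (b i j)) D"
    proof (rule inj_onI)
      fix j j' assume "j \<in> D" "j' \<in> D" "q r (b i j) = q r (b i j')"
      then show "j = j'" using b_eq[of i j i j' 0 r] b[OF i, of j] b[OF i, of j'] i r by auto
    qed
    then have "distinct (map (\<lambda>j. q r (b i j)) [0,1,2,3])"
      unfolding distinct_map D_set by simp
    moreover have "q r (b i j) \<in> D" if "j \<in> D" for j using ran[of "b i j" r] b[OF i that] r by auto
    then have "set (map (\<lambda>j. q r (b i j)) [0,1,2,3]) \<subseteq> set [0,1,2,3]"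
      unfolding set_map D_set by blast
    ultimately show ?thesis
      unfolding perms_def set_filter set_n_lists by simp
  qed
  have ok: "row_ok (row i) (row i')" if i: "i \<in> D" "i' \<in> D" "i \<noteq> i'" for i i'
  proof -
    have ne: "q r (b i j) \<noteq> q r (b i' j)" if "j \<in> D" "r = 2 \<or> r = 3" for j r
      using b_eq[of i j i' j r 1] b[OF i(1), of j] b[OF i(2), of j] i that by auto
    then have "\<forall>j\<in>D. q 2 (b i j) \<noteq> q 2 (b i' j) \<and> q 3 (b i j) \<noteq> q 3 (b i' j)" by blast
    \<comment> \<open>Orthogonality: coordinates 2 and 3 together determine the cell, hence the
      row.\<close>
    moreover have "\<forall>j\<in>D. \<forall>j'\<in>D. (q 2 (b i' j), q 3 (b i' j)) \<noteq> (q 2 (b i j'), q 3 (b i j'))"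
      using b_eq[of i' _ i _ 2 3] i by auto
    ultimately show ?thesis unfolding row_def row_ok_map D_set by blast
  qed
  have hd: "hd (fst (row i)) = i" if "i \<in> D" for i
    using n1[of "b i 0"] b[OF that D_elems(1)] unfolding row_def by simp
  have rows: "row i \<in> set (rows i)" if "i \<in> D" "i \<noteq> 0" for i
  proof -
    have "row i \<in> set (List.product perms perms)"
      using perm[OF that(1), of 2] perm[OF that(1), of 3] unfolding row_def set_product by blast
    then show ?thesis
      unfolding rows_def row0[symmetric] using hd[OF that(1)] ok[OF D_elems(1) that(1)] that(2) by simp
  qed
  have "[row 1, row 2, row 3] =
      [([1,0,3,2],[2,3,0,1]), ([2,3,0,1],[3,2,1,0]), ([3,2,1,0],[1,0,3,2])] \<or> [row 1, row 2, row 3] =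
      [([1,0,3,2],[3,2,1,0]), ([2,3,0,1],[1,0,3,2]), ([3,2,1,0],[2,3,0,1])]" (is "?A \<or> ?B")
  proof -
    have "row 1 \<in> set (rows 1)" "row 2 \<in> set (filter (row_ok (row 1)) (rows 2))"
      "row 3 \<in> set (filter (\<lambda>r. row_ok (row 1) r \<and> row_ok (row 2) r) (rows 3))"
      using rows ok D_elems by simp_all
    then show ?thesis by (rule rows_cases[rule_format])
  qed
  then show ?thesis
  proof
    assume A: ?A
    have *: "\<forall>i\<in>D. \<forall>j\<in>D. [i, 4 + j, 8 + q 2 (b i j), 12 + q 3 (b i j)] \<in> set blocks"
      using A row0 unfolding row_def blocks_def D_set by simp
    have "\<forall>c\<in>B. [q 0 c, 4 + q 1 c, 8 + q 2 c, 12 + q 3 c] \<in> set blocks"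
      (is "\<forall>c\<in>B. ?P c")
    proof
      fix c assume c: "c \<in> B"
      show "?P c" using *[rule_format, OF ran[OF c, of 0] ran[OF c, of 1]] surj[OF c] by simp
    qed
    then show ?thesis by (intro exI[of _ id]) auto
  next
    assume A: ?B
    \<comment> \<open>The Frobenius automorphism of \<open>GF(4)\<close> maps this solution to the first one.\<close>
    define f :: "int \<Rightarrow> int" where "f i = (if i = 2 then 3 else if i = 3 then 2 else i)" for i
    have *: "\<forall>i\<in>D. \<forall>j\<in>D. [f i, 4 + f j, 8 + f (q 2 (b i j)), 12 + f (q 3 (b i j))] \<in> set blocks"
      using A row0 unfolding row_def blocks_def f_def D_set by simp
    have "\<forall>c\<in>B. [f (q 0 c), 4 + f (q 1 c), 8 + f (q 2 c), 12 + f (q 3 c)] \<in> set blocks"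
      (is "\<forall>c\<in>B. ?P c")
    proof
      fix c assume c: "c \<in> B"
      show "?P c" using *[rule_format, OF ran[OF c, of 0] ran[OF c, of 1]] surj[OF c] by simp
    qed
    moreover have "bij_betw f {0..3} {0..3}"
      by (rule bij_betw_byWitness[where f' = f]) (auto simp: f_def)
    ultimately show ?thesis by (intro exI[of _ f]) (auto simp: f_def)
  qed
qed

section \<open>Labelling a transversal design\<close>

text \<open>A block has \<open>k\<close> points, at most one in each of the \<open>k\<close> groups,
  so it misses none.\<close>

lemma transversal_design_meets:
  assumes td: "transversal_design X G B k n" and b: "b \<in> B" and g: "g \<in> G"
  shows "\<exists>!y. y \<in> b \<and> y \<in> g"
proof -
  note D = transversal_designD[OF td]
  have "\<forall>y\<in>b. \<exists>h\<in>G. y \<in> h" using D(3) D(6)[OF b] unfolding partition_on_def by blast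
  then obtain f where f: "\<And>y. y \<in> b \<Longrightarrow> f y \<in> G \<and> y \<in> f y" by metis
  have "inj_on f b" using D(8)[OF b] f by (metis inj_onI)
  then have "card (f ` b) = card G" using D(4,7) b by (simp add: card_image)
  moreover have "finite G" using D(1,3) finite_elements by blast
  ultimately have "f ` b = G" using f by (intro card_subset_eq) auto
  then obtain y where "y \<in> b" "y \<in> g" using g f by blast
  then show ?thesis using D(8)[OF b g] by blast
qed

lemma transversal_design_join:
  assumes td: "transversal_design X G B k n" and gh: "g \<in> G" "h \<in> G" "g \<noteq> h"
    and p: "p \<in> g" and q: "q \<in> h"
  shows "\<exists>b\<in>B. p \<in> b \<and> q \<in> b" "p \<noteq> q"
proof -
  note part = transversal_designD(3)[OF td]
  have disj: "g1 \<inter> g2 = {}" if "g1 \<in> G" "g2 \<in> G" "g1 \<noteq> g2" for g1 g2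
    using part that unfolding partition_on_def disjoint_def by blast
  show "p \<noteq> q" using disj[OF gh] p q by blast
  have "p \<in> X" "q \<in> X" using part gh p q unfolding partition_on_def by blast+
  moreover have "\<nexists>g. g \<in> G \<and> p \<in> g \<and> q \<in> g" using disj gh p q by blast
  ultimately have "\<exists>!b. b \<in> B \<and> p \<in> b \<and> q \<in> b" by (rule transversal_designD(9)[OF td])
  then show "\<exists>b\<in>B. p \<in> b \<and> q \<in> b" by blast
qed

text \<open>Projection from the centre \<open>z\<close>: the block through \<open>z\<close> and
  \<open>y\<close> meets \<open>g'\<close> in one point, \<open>f y\<close>. Conversely
  \<open>z\<close> and \<open>f y\<close> determine the block and hence \<open>y\<close>; equal
  group sizes give surjectivity.\<close>

lemma transversal_design_perspectivity:
  assumes td: "transversal_design X G B k n"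
    and G: "h \<in> G" "g \<in> G" "g' \<in> G" "h \<noteq> g" "h \<noteq> g'" and z: "z \<in> h"
  obtains f where "bij_betw f g g'" "\<And>b y. \<lbrakk>b \<in> B; z \<in> b; y \<in> b; y \<in> g\<rbrakk> \<Longrightarrow> f y \<in> b"
proof -
  have "\<exists>p. p \<in> g' \<and> (\<exists>b\<in>B. z \<in> b \<and> y \<in> b \<and> p \<in> b)" if y: "y \<in> g" for y
    using transversal_design_join(1)[OF td G(1,2,4) z y] transversal_design_meets[OF td _ G(3)] by blast
  then obtain f where f: "\<And>y. y \<in> g \<Longrightarrow> f y \<in> g' \<and> (\<exists>b\<in>B. z \<in> b \<and> y \<in> b \<and> f y \<in> b)" by metis
  have through: "f y \<in> b" if "b \<in> B" "z \<in> b" "y \<in> b" "y \<in> g" for b y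
    using f[OF that(4)] transversal_design_block_unique[OF td _ that(1)]
      transversal_design_join(2)[OF td G(1,2,4) z that(4)] that by metis
  have "inj_on f g"
  proof (rule inj_onI)
    fix y y' assume y: "y \<in> g" "y' \<in> g" "f y = f y'"
    obtain b where b: "b \<in> B" "z \<in> b" "y \<in> b" "f y \<in> b" using f[OF y(1)] by blast
    obtain b' where b': "b' \<in> B" "z \<in> b'" "y' \<in> b'" "f y' \<in> b'" using f[OF y(2)] by blast
    have "z \<noteq> f y" using transversal_design_join(2)[OF td G(1,3,5) z] f[OF y(1)] by blast
    then have "b = b'" using transversal_design_block_unique[OF td b(1) b'(1)] b b' y(3) by metis
    then show "y = y'" using transversal_designD(8)[OF td b(1) G(2)] b b' y by blast
  qed
  moreover have "f ` g = g'"
  proof (rule card_subset_eq)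
    show "finite g'"
      using transversal_designD(1,3)[OF td] G(3) unfolding partition_on_def by (meson Sup_upper finite_subset)
    show "f ` g \<subseteq> g'" using f by blast
    show "card (f ` g) = card g'"
      using \<open>inj_on f g\<close> transversal_designD(5)[OF td] G by (simp add: card_image)
  qed
  ultimately show thesis using that through unfolding bij_betw_def by blast
qed

lemma less_4_cases: "r < (4::nat) \<longleftrightarrow> r = 0 \<or> r = 1 \<or> r = 2 \<or> r = 3"
  by auto

text \<open>Labels are chosen freely on one group and carried to the others by perspectivities,
  which brings about the normalisation required by \<open>orthogonal_array_4\<close>. The group of
  \<open>x\<close> comes first, so that \<open>x\<close> can receive label \<open>0\<close>.\<close>

lemma transversal_design_4_4_labelling:
  assumes td: "transversal_design X G B 4 4" and x: "x \<in> X"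
  obtains l :: "'a \<Rightarrow> int" where "inj_on l X" "l x = 0" "\<And>b. b \<in> B \<Longrightarrow> \<exists>c\<in>set blocks. set c \<subseteq> l ` b"
proof -
  note D = transversal_designD[OF td]
  have part: "\<Union>G = X" using D(3) unfolding partition_on_def by blast
  obtain h where h: "h \<in> G" "x \<in> h" using x part by blast
  have "card (G - {h}) = 3" using h(1) D(4) by simp
  then obtain g1 g2 g3 where g123: "G - {h} = {g1, g2, g3}" "g1 \<noteq> g2" "g2 \<noteq> g3" "g1 \<noteq> g3"
    by (auto simp: card_3_iff)
  have "h \<noteq> g1" "h \<noteq> g2" "h \<noteq> g3" using g123(1) by blast+
  then have dist: "distinct [h, g1, g2, g3]" using g123(2-4) by simp
  define g where "g r = [h, g1, g2, g3] ! r" for r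
  have G: "G = {h, g1, g2, g3}" using g123(1) h(1) by blast
  have g_in: "g r \<in> G" if "r < 4" for r using that unfolding less_4_cases g_def G by auto
  have g_neq: "g r \<noteq> g s" if "r < 4" "s < 4" "r \<noteq> s" for r s
    using that dist unfolding g_def by (subst nth_eq_iff_index_eq) simp_all
  have xg: "x \<in> g 0" using h unfolding g_def by simp
  have cover: "\<exists>r<4. y \<in> g r" if "y \<in> X" for y
  proof -
    have "y \<in> g 0 \<or> y \<in> g 1 \<or> y \<in> g 2 \<or> y \<in> g 3"
      using that unfolding part[symmetric] G g_def by simp
    then show ?thesis unfolding less_4_cases by blast
  qed
  have g_sub: "g r \<subseteq> X" if "r < 4" for r using g_in[OF that] part by blast
  have fin1: "finite (g 1)" using g_sub[of 1] D(1) finite_subset by simp blast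
  have "card (g 1) = card {0..3::int}" using D(5)[OF g_in[of 1]] by simp
  then obtain c1 where c1: "bij_betw c1 (g 1) {0..3::int}"
    using finite_same_card_bij[OF fin1] by blast
  obtain z where z: "z \<in> g 1" "c1 z = 0"
    using bij_betw_imp_surj_on[OF c1] by (metis atLeastAtMost_iff imageE order_refl zero_le_numeral)
  obtain p2 where p2: "bij_betw p2 (g 2) (g 1)"
    "\<And>b y. \<lbrakk>b \<in> B; x \<in> b; y \<in> b; y \<in> g 2\<rbrakk> \<Longrightarrow> p2 y \<in> b"
    using transversal_design_perspectivity[OF td g_in[of 0] g_in[of 2] g_in[of 1] g_neq g_neq xg] by auto
  obtain p3 where p3: "bij_betw p3 (g 3) (g 1)"
    "\<And>b y. \<lbrakk>b \<in> B; x \<in> b; y \<in> b; y \<in> g 3\<rbrakk> \<Longrightarrow> p3 y \<in> b"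
    using transversal_design_perspectivity[OF td g_in[of 0] g_in[of 3] g_in[of 1] g_neq g_neq xg] by auto
  obtain p0 where p0: "bij_betw p0 (g 0) (g 2)"
    "\<And>b y. \<lbrakk>b \<in> B; z \<in> b; y \<in> b; y \<in> g 0\<rbrakk> \<Longrightarrow> p0 y \<in> b"
    using transversal_design_perspectivity[OF td g_in[of 1] g_in[of 0] g_in[of 2] g_neq g_neq z(1)] by auto
  \<comment> \<open>The labels are chosen such that the block through \<open>x\<close> and the point \<open>j\<close> of group 1 has label \<open>j\<close>
    in groups 2 and 3, and the block through \<open>z\<close> and the point \<open>i\<close> of group 0 has label \<open>i\<close> in
    group 2.\<close>
  define c where "c r = [c1 \<circ> p2 \<circ> p0, c1, c1 \<circ> p2, c1 \<circ> p3] ! r" for r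
  have c_simps: "c 0 = c1 \<circ> p2 \<circ> p0" "c 1 = c1" "c 2 = c1 \<circ> p2" "c 3 = c1 \<circ> p3"
    unfolding c_def by simp_all
  have c_bij: "bij_betw (c r) (g r) {0..3}" if "r < 4" for r
    using that c1 p2(1) p3(1) p0(1) unfolding less_4_cases
    by (auto simp: c_simps intro!: bij_betw_trans simp del: One_nat_def)
  define pt where "pt r b = (THE y. y \<in> b \<and> y \<in> g r)" for r b
  have pt: "pt r b \<in> b" "pt r b \<in> g r" if "b \<in> B" "r < 4" for r b
    using theI'[OF transversal_design_meets[OF td that(1) g_in[OF that(2)]]] unfolding pt_def by auto
  have pt_eq: "pt r b = y" if "b \<in> B" "r < 4" "y \<in> b" "y \<in> g r" for r b y
    using pt[OF that(1,2)] D(8)[OF that(1) g_in[OF that(2)]] that by blast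
  define q where "q r b = c r (pt r b)" for r b
  have c_inj: "y = y'" if "r < 4" "y \<in> g r" "y' \<in> g r" "c r y = c r y'" for r y y'
    using c_bij[OF that(1)] that unfolding bij_betw_def inj_on_def by blast
  \<comment> \<open>On the block through \<open>x\<close> and \<open>z\<close>, the map
    \<open>p0\<close> takes \<open>x\<close> to the point in group 2 and \<open>p2\<close> takes
    that point to \<open>z\<close>, whose label is \<open>0\<close>.\<close>
  have c0x: "c 0 x = 0"
  proof -
    obtain b where b: "b \<in> B" "x \<in> b" "z \<in> b"
      using transversal_design_join(1)[OF td g_in[of 0] g_in[of 1] g_neq xg z(1)] by auto
    have "p0 x \<in> b" "p0 x \<in> g 2" using p0 b xg bij_betwE by blast+
    then have "p2 (p0 x) \<in> b" "p2 (p0 x) \<in> g 1" using p2 b bij_betwE by blast+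
    then have "p2 (p0 x) = z" using D(8)[OF b(1) g_in[of 1]] z(1) b(3) by auto
    then show ?thesis using z(2) by (simp add: c_simps)
  qed
  have "\<exists>f. bij_betw f {0..3} {0..3} \<and> f 0 = (0::int) \<and>
    (\<forall>b\<in>B. [f (q 0 b), 4 + f (q 1 b), 8 + f (q 2 b), 12 + f (q 3 b)] \<in> set blocks)"
  proof (rule orthogonal_array_4)
    show "q r b \<in> {0..3}" if "b \<in> B" "r < 4" for b r
      using bij_betwE[OF c_bij[OF that(2)]] pt(2)[OF that] unfolding q_def by blast
    show "\<exists>b\<in>B. q 0 b = i \<and> q 1 b = j" if ij: "i \<in> {0..3}" "j \<in> {0..3}" for i j
    proof -
      obtain u where u: "u \<in> g 0" "c 0 u = i"
        using bij_betw_imp_surj_on[OF c_bij[of 0]] ij(1) by (metis imageE zero_less_numeral)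
      obtain v where v: "v \<in> g 1" "c 1 v = j"
        using bij_betw_imp_surj_on[OF c_bij[of 1]] ij(2) by (metis imageE one_less_numeral_iff semiring_norm(76))
      obtain b where b: "b \<in> B" "u \<in> b" "v \<in> b"
        using transversal_design_join(1)[OF td g_in[of 0] g_in[of 1] g_neq u(1) v(1)] by auto
      have "pt 0 b = u" "pt 1 b = v" using pt_eq b u v by simp_all
      then show ?thesis using b(1) u v unfolding q_def by blast
    qed
    show "b = b'" if b: "b \<in> B" "b' \<in> B" and rs: "r < 4" "s < 4" "r \<noteq> s"
      and q: "q r b = q r b'" "q s b = q s b'" for b b' r s
    proof -
      have "pt r b = pt r b'" "pt s b = pt s b'"
        using c_inj rs pt b q unfolding q_def by blast+
      moreover have "pt r b \<noteq> pt s b"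
        using transversal_design_join(2)[OF td g_in[OF rs(1)] g_in[OF rs(2)] g_neq[OF rs]] pt b rs by blast
      ultimately show ?thesis using transversal_design_block_unique[OF td b] pt b rs by metis
    qed
    show "q 2 b = q 1 b \<and> q 3 b = q 1 b" if b: "b \<in> B" and q0: "q 0 b = 0" for b
    proof -
      have "pt 0 b = x" using c_inj[of 0 "pt 0 b" x] pt[OF b, of 0] xg q0 c0x unfolding q_def by simp
      then have "x \<in> b" using pt[OF b, of 0] by simp
      then have "p2 (pt 2 b) \<in> b" "p2 (pt 2 b) \<in> g 1" "p3 (pt 3 b) \<in> b" "p3 (pt 3 b) \<in> g 1"
        using p2 p3 pt[OF b, of 2] pt[OF b, of 3] b by (simp_all add: bij_betwE)
      then have "pt 1 b = p2 (pt 2 b)" "pt 1 b = p3 (pt 3 b)"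
        using pt_eq[OF b, of 1 "p2 (pt 2 b)"] pt_eq[OF b, of 1 "p3 (pt 3 b)"] by simp_all
      then show ?thesis unfolding q_def c_simps by simp
    qed
    show "q 2 b = q 0 b" if b: "b \<in> B" and q1: "q 1 b = 0" for b
    proof -
      have "pt 1 b = z" using c_inj[of 1 "pt 1 b" z] pt[OF b, of 1] z q1 unfolding q_def c_simps by simp
      then have "z \<in> b" using pt[OF b, of 1] by simp
      then have "p0 (pt 0 b) \<in> b" "p0 (pt 0 b) \<in> g 2"
        using p0 pt[OF b, of 0] b by (simp_all add: bij_betwE)
      then have "pt 2 b = p0 (pt 0 b)" using pt_eq[OF b, of 2 "p0 (pt 0 b)"] by simp
      then show ?thesis unfolding q_def c_simps by simp
    qed
  qed
  then obtain f where f: "bij_betw f {0..3} {0..3}" "f 0 = (0::int)"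
    and fB: "\<And>b. b \<in> B \<Longrightarrow> [f (q 0 b), 4 + f (q 1 b), 8 + f (q 2 b), 12 + f (q 3 b)] \<in> set blocks"
    by blast
  define grp where "grp y = (THE r. r < 4 \<and> y \<in> g r)" for y
  have grp_eq: "grp y = r" if "r < 4" "y \<in> g r" for y r
    unfolding grp_def
  proof (rule the_equality)
    show "s = r" if s: "s < 4 \<and> y \<in> g s" for s
      using transversal_design_join(2)[OF td g_in g_in g_neq] s \<open>r < 4\<close> \<open>y \<in> g r\<close> by blast
  qed (use that in blast)
  \<comment> \<open>The encoding used in \<open>blocks\<close>: base 4, with the group as leading
    digit.\<close>
  define l where "l y = 4 * int (grp y) + f (c (grp y) y)" for y
  have l_eq: "l y = 4 * int r + f (c r y)" if "r < 4" "y \<in> g r" for y r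
    using grp_eq[OF that] unfolding l_def by simp
  have f_ran: "0 \<le> f (c r y) \<and> f (c r y) \<le> 3" if "r < 4" "y \<in> g r" for y r
    using bij_betwE[OF c_bij[OF that(1)]] bij_betwE[OF f(1)] that(2) by (meson atLeastAtMost_iff)
  show thesis
  proof (rule that[of l])
    show "inj_on l X"
    proof (rule inj_onI)
      fix y y' assume y: "y \<in> X" "y' \<in> X" "l y = l y'"
      obtain r where r: "r < 4" "y \<in> g r" using cover[OF y(1)] by blast
      obtain s where s: "s < 4" "y' \<in> g s" using cover[OF y(2)] by blast
      have e: "4 * int r + f (c r y) = 4 * int s + f (c s y')" using y(3) l_eq r s by simp
      then have "r = s" using f_ran[OF r] f_ran[OF s] by presburger
      then have "f (c r y) = f (c r y')" using e by simp
      moreover have "c r y \<in> {0..3}" "c r y' \<in> {0..3}"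
        using bij_betwE[OF c_bij[OF r(1)]] r s \<open>r = s\<close> by blast+
      ultimately have "c r y = c r y'" using f(1) unfolding bij_betw_def inj_on_def by blast
      then show "y = y'" using c_inj r s \<open>r = s\<close> by blast
    qed
    show "l x = 0" using l_eq[OF _ xg] c0x f(2) by simp
    show "\<exists>c\<in>set blocks. set c \<subseteq> l ` b" if b: "b \<in> B" for b
    proof (rule bexI[OF _ fB[OF b]])
      have "4 * int r + f (q r b) \<in> l ` b" if "r < 4" for r
        using l_eq[OF that pt(2)[OF b that]] pt(1)[OF b that] unfolding q_def by (metis imageI)
      from this[of 0] this[of 1] this[of 2] this[of 3]
      show "set [f (q 0 b), 4 + f (q 1 b), 8 + f (q 2 b), 12 + f (q 3 b)] \<subseteq> l ` b" by simp
    qed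
  qed
qed

text \<open>Whatever point Xeno takes first, the labelling sends it to \<open>0\<close>; the
  searched position then dominates the actual one, and the strategy is carried back by
  \<open>breaker_wins_transfer\<close>.\<close>

lemma transversal_design_4_4_draw:
  assumes td: "transversal_design X G B 4 4"
  shows "ophelia_can_force_draw X B"
proof (rule ophelia_can_force_drawI)
  note D = transversal_designD[OF td]
  show "{} \<notin> B" using D(7) by fastforce
  show sub: "b \<subseteq> X" if "b \<in> B" for b using D(6) that .
  fix x assume "x \<in> X"
  then obtain l :: "'a \<Rightarrow> int" where l: "inj_on l X" "l x = 0"
    and blk: "\<And>b. b \<in> B \<Longrightarrow> \<exists>c\<in>set blocks. set c \<subseteq> l ` b"
    using transversal_design_4_4_labelling[OF td] by metis
  have "breaker_wins (set ` set (map (removeAll 0) blocks))"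
  proof (rule breaker_wins_if_survives[OF survives_blocks])
    have "\<forall>c\<in>set blocks. distinct c" by (simp add: blocks_def)
    then show "distinct c" if "c \<in> set (map (removeAll 0) blocks)" for c
      using that by (auto simp: distinct_removeAll)
  qed
  then show "breaker_wins ((\<lambda>b. b - {x}) ` B)"
  proof (rule breaker_wins_transfer[where l = l])
    show "inj_on l (\<Union>((\<lambda>b. b - {x}) ` B))"
      by (rule inj_on_subset[OF l(1)]) (use sub in blast)
    fix b' assume "b' \<in> (\<lambda>b. b - {x}) ` B"
    then obtain b where b: "b \<in> B" "b' = b - {x}" by blast
    obtain c where c: "c \<in> set blocks" "set c \<subseteq> l ` b" using blk[OF b(1)] by blast
    have "set (removeAll 0 c) \<subseteq> l ` b'" using c(2) b(2) l(2) by auto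
    moreover have "set (removeAll 0 c) \<in> set ` set (map (removeAll 0) blocks)"
      unfolding set_map using c(1) by (intro imageI)
    ultimately show "\<exists>c\<in>set ` set (map (removeAll 0) blocks). c \<subseteq> l ` b'" by (rule bexI)
  qed
qed

theorem theorem3p1:
  shows "(\<forall>(X :: 'a set) B v k.
            bibd X B v k 1 \<and> k \<ge> 2 \<and>
            real v < (- real k + 1
                       + sqrt ((real k + 1)^2 + real k * (real k - 1) * 2 ^ (k + 2))) / 2
            \<longrightarrow> ophelia_can_force_draw X (set_mset B))
       \<and> (\<forall>(X :: 'a set) G B k n.
            transversal_design X G B k n \<and> k \<ge> 2 \<and>
            real n \<le> 2 powr (real k / 2) - 1 / 2
            \<longrightarrow> ophelia_can_force_draw X B)
       \<and> (\<forall>(X :: 'a set) G B.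
            transversal_design X G B 4 4 \<longrightarrow> ophelia_can_force_draw X B)"
  using bibd_draw transversal_design_draw transversal_design_4_4_draw by blast

end
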